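(* Let $p\ge 2$ be an integer, let $\zeta\in\mathbb C$ be a primitive $p$-th root of unity, and let $\mathfrak u,\mathfrak v\in M_p(\mathbb C)$ be the Weyl unitary matrices. Then $\mathfrak u$ and $\mathfrak v$ are universal for the commutation relation $uv=\zeta vu$; that is, for every $d\in\mathbb N$ and all $d\times d$ complex unitary matrices $u$ and $v$ such that $u^p=v^p=1_d$ and $uv=\zeta vu$, there exists a unital completely positive linear map $\Phi:M_p(\mathbb C)\to M_d(\mathbb C)$ such that $\Phi(\mathfrak u)=u$ and $\Phi(\mathfrak v)=v$.
   Context: $M_n(\mathbb C)$ is the algebra of complex $n\times n$ matrices with identity $1_n$. The Weyl unitary matrices (with respect to $p$ and $\zeta$) are $\mathfrak u=\mathrm{diag}(1,\zeta,\zeta^2,\dots,\zeta^{p-1})$ and the cyclic shift $\mathfrak v$, whose $(1,p)$-entry and $(k,k-1)$-entries ($2\le k\le p$) are $1$ and whose other entries are $0$. *)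

theory Defs
  imports "Jordan_Normal_Form.Schur_Decomposition"
begin

definition primitive_root_of_unity :: "nat \<Rightarrow> complex \<Rightarrow> bool" where
  "primitive_root_of_unity p \<zeta> \<longleftrightarrow> \<zeta> ^ p = 1 \<and> (\<forall>k. 0 < k \<and> k < p \<longrightarrow> \<zeta> ^ k \<noteq> 1)"

definition unitary_mat :: "nat \<Rightarrow> complex mat \<Rightarrow> bool" where
  "unitary_mat n U \<longleftrightarrow>
     U \<in> carrier_mat n n \<and> mat_adjoint U * U = 1\<^sub>m n \<and> U * mat_adjoint U = 1\<^sub>m n"

text \<open>The order on the complex numbers is that of \<^theory>\<open>HOL-Library.Complex_Order\<close>:
  \<open>0 \<le> z\<close> says that \<open>z\<close> is real and nonnegative.\<close>

definition positive_semidefinite :: "nat \<Rightarrow> complex mat \<Rightarrow> bool" where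
  "positive_semidefinite n A \<longleftrightarrow>
     A \<in> carrier_mat n n \<and> (\<forall>x \<in> carrier_vec n. 0 \<le> (A *\<^sub>v x) \<bullet>c x)"

text \<open>An element of \<open>M\<^sub>k(M\<^sub>n(\<complex>))\<close> is identified with a \<open>kn \<times> kn\<close> matrix cut into \<open>k \<times> k\<close>
  blocks of size \<open>n \<times> n\<close>, with blocks and their entries numbered from \<open>0\<close>. The ampliation
  \<open>id\<^sub>k \<otimes> \<Phi>\<close> of \<open>\<Phi> : M\<^sub>n(\<complex>) \<rightarrow> M\<^sub>m(\<complex>)\<close> applies \<open>\<Phi>\<close> to each block.\<close>

definition mat_block :: "nat \<Rightarrow> complex mat \<Rightarrow> nat \<Rightarrow> nat \<Rightarrow> complex mat" where
  "mat_block n A i j = mat n n (\<lambda>(a, b). A $$ (i * n + a, j * n + b))"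

definition ampliation ::
    "nat \<Rightarrow> nat \<Rightarrow> nat \<Rightarrow> (complex mat \<Rightarrow> complex mat) \<Rightarrow> complex mat \<Rightarrow> complex mat" where
  "ampliation k n m \<Phi> A =
     mat (k * m) (k * m) (\<lambda>(r, c). \<Phi> (mat_block n A (r div m) (c div m)) $$ (r mod m, c mod m))"

definition linear_mat_map :: "nat \<Rightarrow> nat \<Rightarrow> (complex mat \<Rightarrow> complex mat) \<Rightarrow> bool" where
  "linear_mat_map n m \<Phi> \<longleftrightarrow>
     (\<forall>A \<in> carrier_mat n n. \<Phi> A \<in> carrier_mat m m) \<and>
     (\<forall>A \<in> carrier_mat n n. \<forall>B \<in> carrier_mat n n. \<Phi> (A + B) = \<Phi> A + \<Phi> B) \<and>
     (\<forall>c. \<forall>A \<in> carrier_mat n n. \<Phi> (c \<cdot>\<^sub>m A) = c \<cdot>\<^sub>m \<Phi> A)"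

definition completely_positive :: "nat \<Rightarrow> nat \<Rightarrow> (complex mat \<Rightarrow> complex mat) \<Rightarrow> bool" where
  "completely_positive n m \<Phi> \<longleftrightarrow>
     (\<forall>k A. positive_semidefinite (k * n) A \<longrightarrow>
        positive_semidefinite (k * m) (ampliation k n m \<Phi> A))"

definition ucp_map :: "nat \<Rightarrow> nat \<Rightarrow> (complex mat \<Rightarrow> complex mat) \<Rightarrow> bool" where
  "ucp_map n m \<Phi> \<longleftrightarrow>
     linear_mat_map n m \<Phi> \<and> \<Phi> (1\<^sub>m n) = 1\<^sub>m m \<and> completely_positive n m \<Phi>"

definition weyl_u :: "nat \<Rightarrow> complex \<Rightarrow> complex mat" where
  "weyl_u p \<zeta> = mat_diag p (\<lambda>i. \<zeta> ^ i)"

definition weyl_v :: "nat \<Rightarrow> complex mat" where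
  "weyl_v p = mat p p (\<lambda>(i, j). if (i = 0 \<and> j = p - 1) \<or> i = j + 1 then 1 else 0)"

definition universal_for_commutation ::
    "nat \<Rightarrow> complex \<Rightarrow> complex mat \<Rightarrow> complex mat \<Rightarrow> bool" where
  "universal_for_commutation p \<zeta> U V \<longleftrightarrow>
     (\<forall>d u v. unitary_mat d u \<and> unitary_mat d v \<and>
        u ^\<^sub>m p = 1\<^sub>m d \<and> v ^\<^sub>m p = 1\<^sub>m d \<and> u * v = \<zeta> \<cdot>\<^sub>m (v * u) \<longrightarrow>
        (\<exists>\<Phi>. ucp_map p d \<Phi> \<and> \<Phi> U = u \<and> \<Phi> V = v))"

end

theory Submission
  imports Defs
begin

text \<open>Let \<open>P = (1/p) \<Sum>\<^sub>k u\<^sup>k\<close> be the projection onto the fixed space of \<open>u\<close> and put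
  \<open>W\<^sub>a = v\<^sup>a P\<close> for \<open>0 \<le> a < p\<close>. The commutation relation turns \<open>W\<^sub>a W\<^sub>a\<^sup>*\<close> into
  \<open>(1/p) \<Sum>\<^sub>k \<zeta>\<^sup>-\<^sup>a\<^sup>k u\<^sup>k\<close>, the projection onto the \<open>\<zeta>\<^sup>a\<close>-eigenspace of \<open>u\<close>, so these products sum to
  the identity. The map \<open>\<Phi>(A) = \<Sum>\<^sub>a\<^sub>b A\<^sub>a\<^sub>b W\<^sub>a W\<^sub>b\<^sup>*\<close> is therefore unital, and it is completely
  positive for any choice of the \<open>W\<^sub>a\<close>. Since \<open>u W\<^sub>a = \<zeta>\<^sup>a W\<^sub>a\<close> and \<open>v W\<^sub>a = W\<^sub>a\<^sub>+\<^sub>1\<close> (indices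
  modulo \<open>p\<close>), it sends the Weyl matrices to \<open>u\<close> and \<open>v\<close>.\<close>

section \<open>Adjoints, powers and sums of matrices\<close>

lemma mat_adjoint_carrier [simp]:
  "A \<in> carrier_mat n m \<Longrightarrow> mat_adjoint A \<in> carrier_mat m n"
  by (auto simp: mat_adjoint_def)

lemma dim_mat_adjoint [simp]:
  "dim_row (mat_adjoint A) = dim_col A" "dim_col (mat_adjoint A) = dim_row A"
  by (simp_all add: mat_adjoint_def)

lemma index_mat_adjoint:
  assumes "A \<in> carrier_mat n m" "i < m" "j < n"
  shows "mat_adjoint A $$ (i, j) = conjugate (A $$ (j, i))"
  using assms by (auto simp: mat_adjoint_def mat_of_rows_def)

lemma mat_adjoint_mult:
  assumes "A \<in> carrier_mat n m" "B \<in> carrier_mat m l"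
  shows "mat_adjoint (A * B) = mat_adjoint B * mat_adjoint (A :: complex mat)"
proof (rule eq_matI)
  fix i j assume "i < dim_row (mat_adjoint B * mat_adjoint A)"
    "j < dim_col (mat_adjoint B * mat_adjoint A)"
  then have ij: "i < l" "j < n"
    using assms by (auto simp: mat_adjoint_def)
  have "mat_adjoint (A * B) $$ (i, j) = cnj (\<Sum>k<m. A $$ (j, k) * B $$ (k, i))"
    using assms ij by (simp add: index_mat_adjoint[of _ n l] scalar_prod_def atLeast0LessThan)
  also have "\<dots> = (\<Sum>k<m. mat_adjoint B $$ (i, k) * mat_adjoint A $$ (k, j))"
    using assms ij by (simp add: index_mat_adjoint[of A n m] index_mat_adjoint[of B m l] mult.commute)
  also have "\<dots> = (mat_adjoint B * mat_adjoint A) $$ (i, j)"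
    using assms ij by (simp add: scalar_prod_def atLeast0LessThan)
  finally show "mat_adjoint (A * B) $$ (i, j) = (mat_adjoint B * mat_adjoint A) $$ (i, j)" .
qed (use assms in \<open>auto simp: mat_adjoint_def\<close>)

lemma mat_adjoint_adjoint:
  "A \<in> carrier_mat n m \<Longrightarrow> mat_adjoint (mat_adjoint A) = (A :: complex mat)"
  by (rule eq_matI) (auto simp: index_mat_adjoint[of _ m n] index_mat_adjoint[of _ n m])

lemma mat_adjoint_one: "mat_adjoint (1\<^sub>m n) = (1\<^sub>m n :: complex mat)"
  by (rule eq_matI) (auto simp: index_mat_adjoint[of _ n n])

lemma pow_mat_Suc_left:
  assumes "A \<in> carrier_mat n n"
  shows "A * A ^\<^sub>m k = A ^\<^sub>m Suc k"
proof (induction k)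
  case (Suc k)
  have "A * A ^\<^sub>m Suc k = (A * A ^\<^sub>m k) * A"
    using assms by (simp add: assoc_mult_mat[of _ n n _ n _ n])
  also have "\<dots> = A ^\<^sub>m Suc (Suc k)"
    by (simp add: Suc)
  finally show ?case .
qed (use assms in simp)

text \<open>Moving \<open>A\<close> past each of the \<open>k\<close> factors \<open>B\<close>
  contributes one scalar \<open>c\<close>. The lemma serves once for \<open>u\<close> and powers of
  \<open>v\<close>, and once for \<open>v ^\<^sub>m a\<close> and powers of
  \<open>u\<close>.\<close>

lemma pow_mat_commutation:
  fixes c :: "'a :: comm_ring_1"
  assumes A: "A \<in> carrier_mat n n" and B: "B \<in> carrier_mat n n"
    and AB: "A * B = c \<cdot>\<^sub>m (B * A)"
  shows "A * B ^\<^sub>m k = c ^ k \<cdot>\<^sub>m (B ^\<^sub>m k * A)"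
proof (induction k)
  case (Suc k)
  have Bk: "B ^\<^sub>m k \<in> carrier_mat n n"
    using B by simp
  have "A * B ^\<^sub>m Suc k = (A * B ^\<^sub>m k) * B"
    using A B Bk by (simp add: assoc_mult_mat[of _ n n _ n _ n])
  also have "\<dots> = c ^ k \<cdot>\<^sub>m (B ^\<^sub>m k * (A * B))"
    using A B Bk
    by (simp add: Suc mult_smult_assoc_mat[of "B ^\<^sub>m k * A" n n _ n]
        mult_carrier_mat[of _ n n] assoc_mult_mat[of _ n n _ n _ n])
  also have "\<dots> = c ^ Suc k \<cdot>\<^sub>m (B ^\<^sub>m Suc k * A)"
    using A B Bk
    by (simp add: AB mult_smult_distrib[of _ n n _ n] mult_carrier_mat[of _ n n]
        assoc_mult_mat[of _ n n _ n _ n])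
      (auto intro!: eq_matI simp: mult_ac)
  finally show ?case .
qed (use A B in \<open>auto intro!: eq_matI\<close>)

lemma unitary_mat_pow:
  assumes "unitary_mat n v"
  shows "v ^\<^sub>m a * mat_adjoint (v ^\<^sub>m a) = 1\<^sub>m n"
proof (induction a)
  case 0
  then show ?case
    using assms by (auto simp: unitary_mat_def mat_adjoint_one)
next
  case (Suc a)
  have v: "v \<in> carrier_mat n n" and va: "v ^\<^sub>m a \<in> carrier_mat n n"
    and vv: "v * mat_adjoint v = 1\<^sub>m n"
    using assms by (auto simp: unitary_mat_def)
  have "v ^\<^sub>m Suc a * mat_adjoint (v ^\<^sub>m Suc a)
      = v ^\<^sub>m a * ((v * mat_adjoint v) * mat_adjoint (v ^\<^sub>m a))"
    using v va mat_adjoint_carrier[OF v] mat_adjoint_carrier[OF va]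
    by (simp add: mat_adjoint_mult[OF va v] assoc_mult_mat[of _ n n _ n _ n] mult_carrier_mat[of _ n n])
  also have "\<dots> = 1\<^sub>m n"
    by (simp add: vv Suc left_mult_one_mat[OF mat_adjoint_carrier[OF va]])
  finally show ?case .
qed

text \<open>The type \<open>complex mat\<close> contains matrices of every size, so an empty sum has
  no size of its own; hence \<open>d\<close> is an explicit argument and the sum is taken
  entrywise.\<close>

definition mat_sum :: "nat \<Rightarrow> (nat \<Rightarrow> complex mat) \<Rightarrow> nat \<Rightarrow> complex mat" where
  "mat_sum d f p = mat d d (\<lambda>ij. \<Sum>k<p. f k $$ ij)"

lemma mat_sum_carrier [simp]: "mat_sum d f p \<in> carrier_mat d d"
  by (simp add: mat_sum_def)

lemma index_mat_sum:
  "i < d \<Longrightarrow> j < d \<Longrightarrow> mat_sum d f p $$ (i, j) = (\<Sum>k<p. f k $$ (i, j))"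
  by (simp add: mat_sum_def)

lemma mat_sum_cong:
  "(\<And>k. k < p \<Longrightarrow> f k = g k) \<Longrightarrow> mat_sum d f p = mat_sum d g p"
  by (auto simp: mat_sum_def intro!: eq_matI)

lemma mult_mat_sum:
  assumes "A \<in> carrier_mat d d" "\<And>k. k < p \<Longrightarrow> f k \<in> carrier_mat d d"
  shows "A * mat_sum d f p = mat_sum d (\<lambda>k. A * f k) p"
proof (rule eq_matI)
  fix i j assume "i < dim_row (mat_sum d (\<lambda>k. A * f k) p)" "j < dim_col (mat_sum d (\<lambda>k. A * f k) p)"
  then have ij: "i < d" "j < d"
    by (auto simp: mat_sum_def)
  have dims: "dim_row (f k) = d" "dim_col (f k) = d" if "k < p" for k
    using assms(2)[OF that] by auto
  have "(A * mat_sum d f p) $$ (i, j) = (\<Sum>l<d. A $$ (i, l) * (\<Sum>k<p. f k $$ (l, j)))"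
    using assms(1) ij by (simp add: scalar_prod_def mat_sum_def atLeast0LessThan)
  also have "\<dots> = (\<Sum>k<p. \<Sum>l<d. A $$ (i, l) * f k $$ (l, j))"
    unfolding sum_distrib_left by (rule sum.swap)
  also have "\<dots> = mat_sum d (\<lambda>k. A * f k) p $$ (i, j)"
    using assms(1) ij dims by (simp add: index_mat_sum scalar_prod_def atLeast0LessThan)
  finally show "(A * mat_sum d f p) $$ (i, j) = mat_sum d (\<lambda>k. A * f k) p $$ (i, j)" .
qed (use assms in \<open>auto simp: mat_sum_def\<close>)

lemma mat_sum_mult:
  assumes "A \<in> carrier_mat d d" "\<And>k. k < p \<Longrightarrow> f k \<in> carrier_mat d d"
  shows "mat_sum d f p * A = mat_sum d (\<lambda>k. f k * A) p"
proof (rule eq_matI)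
  fix i j assume "i < dim_row (mat_sum d (\<lambda>k. f k * A) p)" "j < dim_col (mat_sum d (\<lambda>k. f k * A) p)"
  then have ij: "i < d" "j < d"
    by (auto simp: mat_sum_def)
  have dims: "dim_row (f k) = d" "dim_col (f k) = d" if "k < p" for k
    using assms(2)[OF that] by auto
  have "(mat_sum d f p * A) $$ (i, j) = (\<Sum>l<d. (\<Sum>k<p. f k $$ (i, l)) * A $$ (l, j))"
    using assms(1) ij by (simp add: scalar_prod_def mat_sum_def atLeast0LessThan)
  also have "\<dots> = (\<Sum>k<p. \<Sum>l<d. f k $$ (i, l) * A $$ (l, j))"
    unfolding sum_distrib_right by (rule sum.swap)
  also have "\<dots> = mat_sum d (\<lambda>k. f k * A) p $$ (i, j)"
    using assms(1) ij dims by (simp add: index_mat_sum scalar_prod_def atLeast0LessThan)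
  finally show "(mat_sum d f p * A) $$ (i, j) = mat_sum d (\<lambda>k. f k * A) p $$ (i, j)" .
qed (use assms in \<open>auto simp: mat_sum_def\<close>)

text \<open>The shift drops the term at \<open>0\<close> and gains the one at \<open>p\<close>, and
  these two agree.\<close>

lemma mat_sum_Suc_cyclic:
  assumes "f p = f 0"
  shows "mat_sum d (\<lambda>k. f (Suc k)) p = mat_sum d f p"
proof (rule eq_matI)
  fix i j assume "i < dim_row (mat_sum d f p)" "j < dim_col (mat_sum d f p)"
  then have ij: "i < d" "j < d"
    by (auto simp: mat_sum_def)
  have "f 0 $$ (i, j) + (\<Sum>k<p. f (Suc k) $$ (i, j)) = (\<Sum>k<p. f k $$ (i, j)) + f p $$ (i, j)"
    using sum.lessThan_Suc_shift[of "\<lambda>k. f k $$ (i, j)" p] sum.lessThan_Suc[of "\<lambda>k. f k $$ (i, j)" p]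
    by simp
  then show "mat_sum d (\<lambda>k. f (Suc k)) p $$ (i, j) = mat_sum d f p $$ (i, j)"
    using ij assms by (simp add: index_mat_sum)
qed (auto simp: mat_sum_def)


section \<open>Completely positive maps built from a row of matrices\<close>

text \<open>With the block row R = [\<open>W 0\<close>, ..., \<open>W (p - 1)\<close>] this is R (A
  tensor 1) R', where R' is the adjoint of R: a Stinespring form, which explains complete
  positivity.\<close>

definition row_map :: "nat \<Rightarrow> nat \<Rightarrow> (nat \<Rightarrow> complex mat) \<Rightarrow> complex mat \<Rightarrow> complex mat" where
  "row_map p d W A =
     mat d d (\<lambda>rs. \<Sum>a<p. \<Sum>b<p. A $$ (a, b) * (W a * mat_adjoint (W b)) $$ rs)"

lemma sum_lessThan_mult:
  fixes f :: "nat \<Rightarrow> 'a :: comm_monoid_add"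
  shows "sum f {..<k * n} = (\<Sum>i<k. \<Sum>r<n. f (i * n + r))"
proof -
  have "sum f {i * n..<i * n + n} = (\<Sum>r<n. f (i * n + r))" for i
    using sum.shift_bounds_nat_ivl[of f 0 "i * n" n]
    by (simp add: atLeast0LessThan add.commute)
  then show ?thesis
    by (simp flip: sum.nat_group)
qed

lemma quadratic_form_expand:
  assumes "A \<in> carrier_mat n n" "x \<in> carrier_vec n"
  shows "(A *\<^sub>v x) \<bullet>c x = (\<Sum>i<n. \<Sum>j<n. A $$ (i, j) * x $ j * cnj (x $ i))"
  using assms by (simp add: scalar_prod_def sum_distrib_right atLeast0LessThan)

lemma block_index_less:
  fixes i k a n :: nat
  assumes "i < k" "a < n"
  shows "i * n + a < k * n"
proof -
  have "i * n + a < Suc i * n"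
    using assms by simp
  also have "\<dots> \<le> k * n"
    using assms by (intro mult_le_mono1) simp
  finally show ?thesis .
qed

lemma completely_positive_row_map:
  assumes W: "\<And>a. a < p \<Longrightarrow> W a \<in> carrier_mat d d"
  shows "completely_positive p d (row_map p d W)"
  unfolding completely_positive_def
proof (intro allI impI)
  fix k A assume psd: "positive_semidefinite (k * p) A"
  then have A: "A \<in> carrier_mat (k * p) (k * p)"
    by (simp add: positive_semidefinite_def)
  let ?M = "ampliation k p d (row_map p d W) A"
  have M: "?M \<in> carrier_mat (k * d) (k * d)"
    by (simp add: ampliation_def)
  have M_index: "?M $$ (i * d + r, j * d + s) =
      (\<Sum>a<p. \<Sum>b<p. \<Sum>t<d. A $$ (i * p + a, j * p + b) * W a $$ (r, t) * cnj (W b $$ (s, t)))"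
    if "i < k" "j < k" "r < d" "s < d" for i j r s
  proof -
    have "(W a * mat_adjoint (W b)) $$ (r, s) = (\<Sum>t<d. W a $$ (r, t) * cnj (W b $$ (s, t)))"
      if "a < p" "b < p" for a b
      using W[OF \<open>a < p\<close>] W[OF \<open>b < p\<close>] mat_adjoint_carrier[OF W[OF \<open>b < p\<close>]] \<open>r < d\<close> \<open>s < d\<close>
      by (simp add: scalar_prod_def atLeast0LessThan index_mat_adjoint[of _ d d])
    with that show ?thesis
      by (simp add: ampliation_def block_index_less row_map_def mat_block_def
          sum_distrib_left mult.assoc)
  qed
  have "0 \<le> (?M *\<^sub>v x) \<bullet>c x" if x: "x \<in> carrier_vec (k * d)" for x
  proof -
    \<comment> \<open>\<open>y t\<close> collects the \<open>t\<close>-th coordinates of the vectors \<open>W\<^sub>b\<^sup>* x\<^sub>j\<close>, where \<open>x\<^sub>j\<close> is the \<open>j\<close>-th block of \<open>x\<close>;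
      the quadratic form of the ampliation at \<open>x\<close> is the sum of those of \<open>A\<close> at the \<open>y t\<close>.\<close>
    define y where "y t = vec (k * p)
      (\<lambda>m. \<Sum>s<d. cnj (W (m mod p) $$ (s, t)) * x $ ((m div p) * d + s))" for t
    have y: "y t \<in> carrier_vec (k * p)" for t
      by (simp add: y_def)
    have y_index: "y t $ (j * p + b) = (\<Sum>s<d. cnj (W b $$ (s, t)) * x $ (j * d + s))"
      if "j < k" "b < p" for t j b
      using that by (simp add: y_def block_index_less)
    have block_form: "(\<Sum>r<d. \<Sum>s<d. ?M $$ (i * d + r, j * d + s) * x $ (j * d + s) * cnj (x $ (i * d + r)))
        = (\<Sum>t<d. \<Sum>a<p. \<Sum>b<p. A $$ (i * p + a, j * p + b) * y t $ (j * p + b) * cnj (y t $ (i * p + a)))"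
      if ij: "i < k" "j < k" for i j
    proof -
      \<comment> \<open>\<open>g\<close> is the common summand of both sides, so the identity
        becomes a reordering of a fivefold sum. Pairing \<open>(r, s)\<close> and
        \<open>(a, b)\<close> below lets two indices be exchanged at a time.\<close>
      define g where "g r s a b t = A $$ (i * p + a, j * p + b) * W a $$ (r, t) * cnj (W b $$ (s, t))
        * x $ (j * d + s) * cnj (x $ (i * d + r))" for r s a b t
      have "(\<Sum>r<d. \<Sum>s<d. ?M $$ (i * d + r, j * d + s) * x $ (j * d + s) * cnj (x $ (i * d + r)))
          = (\<Sum>r<d. \<Sum>s<d. \<Sum>a<p. \<Sum>b<p. \<Sum>t<d. g r s a b t)"
        using ij by (simp add: M_index g_def sum_distrib_right)
      also have "\<dots> = (\<Sum>(r, s)\<in>{..<d} \<times> {..<d}. \<Sum>(a, b)\<in>{..<p} \<times> {..<p}. \<Sum>t<d. g r s a b t)"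
        by (simp flip: sum.cartesian_product)
      also have "\<dots> = (\<Sum>(a, b)\<in>{..<p} \<times> {..<p}. \<Sum>(r, s)\<in>{..<d} \<times> {..<d}. \<Sum>t<d. g r s a b t)"
        unfolding case_prod_unfold by (rule sum.swap)
      also have "\<dots> = (\<Sum>(a, b)\<in>{..<p} \<times> {..<p}. \<Sum>t<d. \<Sum>(r, s)\<in>{..<d} \<times> {..<d}. g r s a b t)"
        unfolding case_prod_unfold by (intro sum.cong refl sum.swap)
      also have "\<dots> = (\<Sum>t<d. \<Sum>(a, b)\<in>{..<p} \<times> {..<p}. \<Sum>(r, s)\<in>{..<d} \<times> {..<d}. g r s a b t)"
        unfolding case_prod_unfold by (rule sum.swap)
      also have "\<dots> = (\<Sum>t<d. \<Sum>a<p. \<Sum>b<p. \<Sum>r<d. \<Sum>s<d. g r s a b t)"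
        by (simp flip: sum.cartesian_product)
      \<comment> \<open>For fixed \<open>t\<close>, \<open>a\<close>, \<open>b\<close> the double
        sum factors: the sum over \<open>s\<close> is an entry of \<open>y t\<close>, the sum over
        \<open>r\<close> the conjugate of one.\<close>
      also have "\<dots> = (\<Sum>t<d. \<Sum>a<p. \<Sum>b<p.
          A $$ (i * p + a, j * p + b) * y t $ (j * p + b) * cnj (y t $ (i * p + a)))"
      proof (intro sum.cong refl)
        fix t a b assume "a \<in> {..<p}" "b \<in> {..<p}"
        then show "(\<Sum>r<d. \<Sum>s<d. g r s a b t)
          = A $$ (i * p + a, j * p + b) * y t $ (j * p + b) * cnj (y t $ (i * p + a))"
          using ij
          by (subst sum.swap) (simp add: y_index g_def sum_distrib_left sum_distrib_right mult_ac)
      qed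
      finally show ?thesis .
    qed
    have "(?M *\<^sub>v x) \<bullet>c x = (\<Sum>i<k. \<Sum>r<d. \<Sum>j<k. \<Sum>s<d.
        ?M $$ (i * d + r, j * d + s) * x $ (j * d + s) * cnj (x $ (i * d + r)))"
      by (simp add: quadratic_form_expand[OF M x] sum_lessThan_mult)
    also have "\<dots> = (\<Sum>i<k. \<Sum>j<k. \<Sum>r<d. \<Sum>s<d.
        ?M $$ (i * d + r, j * d + s) * x $ (j * d + s) * cnj (x $ (i * d + r)))"
      by (intro sum.cong refl sum.swap)
    also have "\<dots> = (\<Sum>i<k. \<Sum>j<k. \<Sum>t<d. \<Sum>a<p. \<Sum>b<p.
        A $$ (i * p + a, j * p + b) * y t $ (j * p + b) * cnj (y t $ (i * p + a)))"
      by (intro sum.cong refl block_form) auto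
    also have "\<dots> = (\<Sum>t<d. \<Sum>i<k. \<Sum>j<k. \<Sum>a<p. \<Sum>b<p.
        A $$ (i * p + a, j * p + b) * y t $ (j * p + b) * cnj (y t $ (i * p + a)))"
      by (subst (2) sum.swap, subst sum.swap) (rule refl)
    \<comment> \<open>Each block number must stand next to its inner index, so that the pairs
      \<open>(i, a)\<close> and \<open>(j, b)\<close> merge into single indices below
      \<open>k * p\<close>.\<close>
    also have "\<dots> = (\<Sum>t<d. \<Sum>i<k. \<Sum>a<p. \<Sum>j<k. \<Sum>b<p.
        A $$ (i * p + a, j * p + b) * y t $ (j * p + b) * cnj (y t $ (i * p + a)))"
      by (intro sum.cong refl sum.swap)
    also have "\<dots> = (\<Sum>t<d. (A *\<^sub>v y t) \<bullet>c y t)"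
      by (simp add: quadratic_form_expand[OF A y] sum_lessThan_mult)
    also have "\<dots> \<ge> 0"
      using psd y by (intro sum_nonneg) (auto simp: positive_semidefinite_def)
    finally show ?thesis .
  qed
  with M show "positive_semidefinite (k * d) ?M"
    by (simp add: positive_semidefinite_def)
qed

section \<open>Linearity and values on diagonal matrices and the cyclic shift\<close>

lemma linear_row_map: "linear_mat_map p d (row_map p d W)"
  by (auto simp: linear_mat_map_def row_map_def algebra_simps sum.distrib sum_distrib_left
      intro!: eq_matI)

lemma row_map_mat_diag:
  assumes W: "\<And>a. a < p \<Longrightarrow> W a \<in> carrier_mat d d"
  shows "row_map p d W (mat_diag p f) = mat_sum d (\<lambda>a. f a \<cdot>\<^sub>m (W a * mat_adjoint (W a))) p"
proof (rule eq_matI)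
  fix r s assume "r < dim_row (mat_sum d (\<lambda>a. f a \<cdot>\<^sub>m (W a * mat_adjoint (W a))) p)"
    "s < dim_col (mat_sum d (\<lambda>a. f a \<cdot>\<^sub>m (W a * mat_adjoint (W a))) p)"
  then have rs: "r < d" "s < d"
    by (auto simp: mat_sum_def)
  have "row_map p d W (mat_diag p f) $$ (r, s)
      = (\<Sum>a<p. \<Sum>b<p. if a = b then f b * (W a * mat_adjoint (W b)) $$ (r, s) else 0)"
    using rs by (simp add: row_map_def mat_diag_def if_distrib[of "\<lambda>x. x * _"] del: index_mult_mat
        cong: if_cong)
  also have "\<dots> = (\<Sum>a<p. f a * (W a * mat_adjoint (W a)) $$ (r, s))"
  proof (intro sum.cong refl)
    fix a assume "a \<in> {..<p}"
    then show "(\<Sum>b<p. if a = b then f b * (W a * mat_adjoint (W b)) $$ (r, s) else 0)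
        = f a * (W a * mat_adjoint (W a)) $$ (r, s)"
      by (subst sum.delta') auto
  qed
  also have "\<dots> = (\<Sum>a<p. (f a \<cdot>\<^sub>m (W a * mat_adjoint (W a))) $$ (r, s))"
    using rs W by (intro sum.cong refl) (subst index_smult_mat, auto dest!: W)
  finally show "row_map p d W (mat_diag p f) $$ (r, s)
      = mat_sum d (\<lambda>a. f a \<cdot>\<^sub>m (W a * mat_adjoint (W a))) p $$ (r, s)"
    using rs by (simp add: index_mat_sum)
qed (auto simp: mat_sum_def row_map_def)

lemma row_map_weyl_v:
  assumes "p \<ge> 2"
  shows "row_map p d W (weyl_v p) = mat_sum d (\<lambda>b. W (Suc b mod p) * mat_adjoint (W b)) p"
proof (rule eq_matI)
  fix r s assume "r < dim_row (mat_sum d (\<lambda>b. W (Suc b mod p) * mat_adjoint (W b)) p)"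
    "s < dim_col (mat_sum d (\<lambda>b. W (Suc b mod p) * mat_adjoint (W b)) p)"
  then have rs: "r < d" "s < d"
    by (auto simp: mat_sum_def)
  \<comment> \<open>Indices start at \<open>0\<close>, so the corner entry in row \<open>0\<close>
    and column \<open>p - 1\<close> is the wrap-around case \<open>Suc b = p\<close>. Each column
    thus has a single 1.\<close>
  have entry: "weyl_v p $$ (a, b) = (if a = Suc b mod p then 1 else 0)" if "a < p" "b < p" for a b
    using that assms by (cases "Suc b = p") (auto simp: weyl_v_def)
  have "row_map p d W (weyl_v p) $$ (r, s)
      = (\<Sum>a<p. \<Sum>b<p. weyl_v p $$ (a, b) * (W a * mat_adjoint (W b)) $$ (r, s))"
    using rs by (simp add: row_map_def)
  also have "\<dots> = (\<Sum>b<p. \<Sum>a<p. weyl_v p $$ (a, b) * (W a * mat_adjoint (W b)) $$ (r, s))"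
    by (rule sum.swap)
  also have "\<dots> = (\<Sum>b<p. \<Sum>a<p. if a = Suc b mod p then (W a * mat_adjoint (W b)) $$ (r, s) else 0)"
    by (intro sum.cong refl) (simp add: entry)
  also have "\<dots> = (\<Sum>b<p. (W (Suc b mod p) * mat_adjoint (W b)) $$ (r, s))"
    using assms by (simp add: sum.delta del: index_mult_mat)
  finally show "row_map p d W (weyl_v p) $$ (r, s)
      = mat_sum d (\<lambda>b. W (Suc b mod p) * mat_adjoint (W b)) p $$ (r, s)"
    using rs by (simp add: index_mat_sum)
qed (auto simp: mat_sum_def row_map_def)


section \<open>The spectral projection of a unitary of finite order\<close>

definition fixed_projection :: "nat \<Rightarrow> nat \<Rightarrow> complex mat \<Rightarrow> complex mat" where
  "fixed_projection d p u = mat_sum d (\<lambda>k. (1 / of_nat p) \<cdot>\<^sub>m u ^\<^sub>m k) p"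

lemma fixed_projection_carrier [simp]: "fixed_projection d p u \<in> carrier_mat d d"
  by (simp add: fixed_projection_def)

text \<open>Multiplication by \<open>u\<close> shifts the powers in the average by one, a cyclic
  shift because the \<open>p\<close>-th power is the identity.\<close>

lemma mult_fixed_projection:
  assumes u: "u \<in> carrier_mat d d" and "u ^\<^sub>m p = 1\<^sub>m d"
  shows "u * fixed_projection d p u = fixed_projection d p u"
proof -
  have "u * fixed_projection d p u = mat_sum d (\<lambda>k. (1 / of_nat p) \<cdot>\<^sub>m u ^\<^sub>m Suc k) p"
    unfolding fixed_projection_def using u
    by (subst mult_mat_sum) (auto simp: mult_smult_distrib[of _ d d _ d] pow_mat_Suc_left
        simp del: pow_mat.simps(2))
  also have "\<dots> = fixed_projection d p u"
    unfolding fixed_projection_def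
    using assms by (intro mat_sum_Suc_cyclic) (simp add: carrier_matD[OF u])
  finally show ?thesis .
qed

lemma fixed_projection_is_projection:
  assumes "p > 0" and U: "unitary_mat d u" and "u ^\<^sub>m p = 1\<^sub>m d"
  shows "fixed_projection d p u * mat_adjoint (fixed_projection d p u) = fixed_projection d p u"
proof -
  \<comment> \<open>\<open>P\<^sup>* u = P\<^sup>*\<close> gives \<open>P\<^sup>* P = P\<^sup>*\<close>, and \<open>P\<^sup>* P\<close> is self-adjoint.\<close>
  let ?P = "fixed_projection d p u" and ?Q = "mat_adjoint (fixed_projection d p u)"
  have u: "u \<in> carrier_mat d d" and uu: "mat_adjoint u * u = 1\<^sub>m d"
    using U by (auto simp: unitary_mat_def)
  have P: "?P \<in> carrier_mat d d" and Q: "?Q \<in> carrier_mat d d"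
    by simp_all
  \<comment> \<open>Unitarity turns invariance of \<open>?P\<close> under \<open>u\<close> into
    invariance under its adjoint; taking adjoints then gives \<open>?Q * u = ?Q\<close>.\<close>
  have "mat_adjoint u * ?P = mat_adjoint u * (u * ?P)"
    by (simp add: mult_fixed_projection[OF u assms(3)])
  also have "\<dots> = ?P"
    using u by (simp add: uu left_mult_one_mat[OF P] flip: assoc_mult_mat[of _ d d _ d _ d])
  finally have "mat_adjoint (mat_adjoint u * ?P) = ?Q"
    by simp
  then have Qu: "?Q * u = ?Q"
    using u by (simp add: mat_adjoint_mult[of _ d d _ d] mat_adjoint_adjoint)
  have Quk: "?Q * u ^\<^sub>m k = ?Q" for k
  proof (induction k)
    case (Suc k)
    then show ?case
      using u Q Qu by (simp flip: assoc_mult_mat[of _ d d _ d _ d])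
  qed (use u right_mult_one_mat[OF Q] in simp)
  \<comment> \<open>\<open>?Q\<close> absorbs every power of \<open>u\<close>, so the average leaves
    \<open>p\<close> equal terms of weight 1/p.\<close>
  have "?Q * ?P = mat_sum d (\<lambda>k. (1 / of_nat p) \<cdot>\<^sub>m ?Q) p"
    using u Q by (subst (2) fixed_projection_def, subst mult_mat_sum)
      (auto simp: mult_smult_distrib[of _ d d _ d] Quk)
  also have "\<dots> = ?Q"
    using \<open>p > 0\<close> carrier_matD[OF Q] by (auto simp: mat_sum_def intro!: eq_matI)
  finally have QP: "?Q * ?P = ?Q" .
  moreover have "mat_adjoint (?Q * ?P) = ?Q * ?P"
    by (simp add: mat_adjoint_mult[OF Q P] mat_adjoint_adjoint[OF P])
  ultimately have "?Q = ?P"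
    by (simp add: mat_adjoint_adjoint[OF P])
  with QP show ?thesis
    by simp
qed

text \<open>For \<open>k\<close> nonzero this is a geometric sum with ratio \<zeta>^(-k).
  Primitivity keeps the ratio away from 1, while its \<open>p\<close>-th power is 1.\<close>

lemma sum_inverse_root_power:
  assumes "primitive_root_of_unity p \<zeta>" "k < p"
  shows "(\<Sum>a<p. (inverse \<zeta> ^ a) ^ k) = (if k = 0 then of_nat p else 0)"
proof (cases "k = 0")
  case False
  with assms have "\<zeta> ^ k \<noteq> 1" "\<zeta> ^ p = 1"
    by (auto simp: primitive_root_of_unity_def)
  moreover have "(\<zeta> ^ k) ^ p = (\<zeta> ^ p) ^ k"
    by (simp add: mult.commute flip: power_mult)
  ultimately have "inverse \<zeta> ^ k \<noteq> 1" "(inverse \<zeta> ^ k) ^ p = 1"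
    by (simp_all add: power_inverse)
  moreover have "(\<Sum>a<p. (inverse \<zeta> ^ a) ^ k) = (\<Sum>a<p. (inverse \<zeta> ^ k) ^ a)"
    by (simp add: mult.commute flip: power_mult)
  ultimately show ?thesis
    using False by (simp add: geometric_sum)
qed simp


section \<open>The matrix units of a Weyl pair\<close>

locale weyl_pair =
  fixes p d :: nat and \<zeta> :: complex and u v :: "complex mat"
  assumes p: "p \<ge> 2"
    and \<zeta>: "primitive_root_of_unity p \<zeta>"
    and u: "unitary_mat d u"
    and v: "unitary_mat d v"
    and u_pow: "u ^\<^sub>m p = 1\<^sub>m d"
    and v_pow: "v ^\<^sub>m p = 1\<^sub>m d"
    and uv: "u * v = \<zeta> \<cdot>\<^sub>m (v * u)"
begin

text \<open>\<open>W a * mat_adjoint (W b)\<close> will be the image of the matrix unit with its 1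
  at \<open>(a, b)\<close>, for \<open>a\<close> and \<open>b\<close> below
  \<open>p\<close>.\<close>

definition W :: "nat \<Rightarrow> complex mat" where
  "W a = v ^\<^sub>m a * fixed_projection d p u"

lemma u_carrier: "u \<in> carrier_mat d d"
  using u by (simp add: unitary_mat_def)

lemma v_carrier: "v \<in> carrier_mat d d"
  using v by (simp add: unitary_mat_def)

lemma W_carrier [simp]: "W a \<in> carrier_mat d d"
  using pow_carrier_mat[OF v_carrier] by (simp add: W_def mult_carrier_mat[of _ d d])

lemma zeta_nonzero: "\<zeta> \<noteq> 0"
  using \<zeta> p by (auto simp: primitive_root_of_unity_def power_0_left)

lemma u_v_pow: "u * v ^\<^sub>m a = \<zeta> ^ a \<cdot>\<^sub>m (v ^\<^sub>m a * u)"
  by (rule pow_mat_commutation[OF u_carrier v_carrier uv])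

text \<open>Solving \<open>u_v_pow\<close> for \<open>v ^\<^sub>m a * u\<close> gives a commutation
  relation with scalar \<zeta>^(-a), which is then iterated over the powers of
  \<open>u\<close>.\<close>

lemma v_pow_u_pow: "v ^\<^sub>m a * u ^\<^sub>m k = (inverse \<zeta> ^ a) ^ k \<cdot>\<^sub>m (u ^\<^sub>m k * v ^\<^sub>m a)"
proof (rule pow_mat_commutation)
  show "v ^\<^sub>m a * u = inverse \<zeta> ^ a \<cdot>\<^sub>m (u * v ^\<^sub>m a)"
    using zeta_nonzero u_carrier v_carrier
    by (simp only: u_v_pow) (auto intro!: eq_matI simp: power_inverse)
qed (use u_carrier v_carrier in auto)

text \<open>Moving \<open>u\<close> past \<open>v ^\<^sub>m a\<close> costs \<zeta>^a, and the
  projection then absorbs \<open>u\<close>.\<close>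

lemma u_W: "u * W a = \<zeta> ^ a \<cdot>\<^sub>m W a"
proof -
  have va: "v ^\<^sub>m a \<in> carrier_mat d d"
    using v_carrier by simp
  have "u * W a = (u * v ^\<^sub>m a) * fixed_projection d p u"
    using u_carrier va by (simp add: W_def assoc_mult_mat[of _ d d _ d _ d])
  also have "\<dots> = \<zeta> ^ a \<cdot>\<^sub>m (v ^\<^sub>m a * (u * fixed_projection d p u))"
    using u_carrier va
    by (simp add: u_v_pow mult_smult_assoc_mat[of _ d d _ d] assoc_mult_mat[of _ d d _ d _ d])
  finally show ?thesis
    by (simp add: W_def mult_fixed_projection[OF u_carrier u_pow])
qed

lemma v_W:
  assumes "b < p"
  shows "W (Suc b mod p) = v * W b"
proof -
  \<comment> \<open>At the wrap-around \<open>Suc b = p\<close>, both powers are the identity by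
    \<open>v_pow\<close>.\<close>
  have "v ^\<^sub>m (Suc b mod p) = v ^\<^sub>m Suc b"
    using assms v_carrier v_pow by (cases "Suc b = p") auto
  also have "\<dots> = v * v ^\<^sub>m b"
    by (simp only: pow_mat_Suc_left[OF v_carrier])
  finally show ?thesis
    using v_carrier by (simp add: W_def assoc_mult_mat[of _ d d _ d _ d])
qed

text \<open>The two projections collapse into one, leaving its conjugate by the unitary
  \<open>v ^\<^sub>m a\<close>. This conjugation multiplies the \<open>k\<close>-th power of
  \<open>u\<close> by \<zeta>^(-ak).\<close>

lemma W_adjoint:
  "W a * mat_adjoint (W a)
    = mat_sum d (\<lambda>k. ((inverse \<zeta> ^ a) ^ k / of_nat p) \<cdot>\<^sub>m u ^\<^sub>m k) p"
proof -
  let ?P = "fixed_projection d p u"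
  let ?V = "mat_adjoint (v ^\<^sub>m a)"
  have va: "v ^\<^sub>m a \<in> carrier_mat d d" and V: "?V \<in> carrier_mat d d"
    using v_carrier by simp_all
  have uk: "u ^\<^sub>m k \<in> carrier_mat d d" for k
    using u_carrier by simp
  have P: "?P \<in> carrier_mat d d" "mat_adjoint ?P \<in> carrier_mat d d"
    by simp_all
  have "W a * mat_adjoint (W a) = v ^\<^sub>m a * (?P * mat_adjoint ?P) * ?V"
    using va V P by (simp add: W_def mat_adjoint_mult[of _ d d _ d] assoc_mult_mat[of _ d d _ d _ d]
        mult_carrier_mat[of _ d d])
  also have "\<dots> = v ^\<^sub>m a * ?P * ?V"
    using p by (simp add: fixed_projection_is_projection[OF _ u u_pow])
  also have "\<dots> = mat_sum d (\<lambda>k. v ^\<^sub>m a * ((1 / of_nat p) \<cdot>\<^sub>m u ^\<^sub>m k) * ?V) p"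
    unfolding fixed_projection_def using va V uk
    by (simp add: mult_mat_sum mat_sum_mult mult_carrier_mat[of _ d d])
  also have "\<dots> = mat_sum d (\<lambda>k. ((inverse \<zeta> ^ a) ^ k / of_nat p) \<cdot>\<^sub>m u ^\<^sub>m k) p"
  proof (rule mat_sum_cong)
    fix k
    let ?c = "(inverse \<zeta> ^ a) ^ k"
    have "v ^\<^sub>m a * ((1 / of_nat p) \<cdot>\<^sub>m u ^\<^sub>m k) * ?V
        = (1 / of_nat p) \<cdot>\<^sub>m ((v ^\<^sub>m a * u ^\<^sub>m k) * ?V)"
      using va V uk[of k] by (simp add: mult_smult_distrib[of _ d d _ d]
          mult_smult_assoc_mat[of "v ^\<^sub>m a * u ^\<^sub>m k" d d _ d] mult_carrier_mat[of _ d d])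
    also have "\<dots> = (1 / of_nat p) \<cdot>\<^sub>m (?c \<cdot>\<^sub>m (u ^\<^sub>m k * v ^\<^sub>m a * ?V))"
      unfolding v_pow_u_pow
      using va V uk[of k]
      by (simp add: mult_smult_assoc_mat[of "u ^\<^sub>m k * v ^\<^sub>m a" d d _ d] mult_carrier_mat[of _ d d])
    also have "u ^\<^sub>m k * v ^\<^sub>m a * ?V = u ^\<^sub>m k"
      using va V uk[of k] by (simp add: assoc_mult_mat[of _ d d _ d _ d]
          unitary_mat_pow[OF v] right_mult_one_mat[OF uk])
    finally show "v ^\<^sub>m a * ((1 / of_nat p) \<cdot>\<^sub>m u ^\<^sub>m k) * ?V = (?c / of_nat p) \<cdot>\<^sub>m u ^\<^sub>m k"
      by (auto intro!: eq_matI)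
  qed
  finally show ?thesis .
qed

text \<open>Summing over \<open>a\<close> first, the coefficient of the \<open>k\<close>-th power of
  \<open>u\<close> is a root-of-unity sum divided by \<open>p\<close>; it vanishes unless
  \<open>k = 0\<close>.\<close>

lemma sum_W_adjoint: "mat_sum d (\<lambda>a. W a * mat_adjoint (W a)) p = 1\<^sub>m d"
proof (rule eq_matI)
  fix r s assume "r < dim_row (1\<^sub>m d :: complex mat)" "s < dim_col (1\<^sub>m d :: complex mat)"
  then have rs: "r < d" "s < d"
    by auto
  have "mat_sum d (\<lambda>a. W a * mat_adjoint (W a)) p $$ (r, s)
      = (\<Sum>a<p. \<Sum>k<p. (inverse \<zeta> ^ a) ^ k / of_nat p * (u ^\<^sub>m k) $$ (r, s))"
    using rs u_carrier by (simp add: index_mat_sum W_adjoint)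
  also have "\<dots> = (\<Sum>k<p. (\<Sum>a<p. (inverse \<zeta> ^ a) ^ k) / of_nat p * (u ^\<^sub>m k) $$ (r, s))"
    by (subst sum.swap) (simp add: sum_distrib_right sum_divide_distrib)
  also have "\<dots> = (\<Sum>k<p. if k = 0 then (u ^\<^sub>m k) $$ (r, s) else 0)"
    using p by (intro sum.cong refl) (simp add: sum_inverse_root_power[OF \<zeta>])
  also have "\<dots> = 1\<^sub>m d $$ (r, s)"
    using p u_carrier by (simp add: sum.delta)
  finally show "mat_sum d (\<lambda>a. W a * mat_adjoint (W a)) p $$ (r, s) = 1\<^sub>m d $$ (r, s)" .
qed (auto simp: mat_sum_def)

lemma WW_carrier: "W a * mat_adjoint (W b) \<in> carrier_mat d d"
  by (rule mult_carrier_mat[of _ d d]) auto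

text \<open>The diagonal entry \<zeta>^a is traded for a left factor \<open>u\<close> by
  \<open>u_W\<close>, and \<open>u\<close> then factors out of the resolution of the
  identity.\<close>

lemma row_map_u: "row_map p d W (weyl_u p \<zeta>) = u"
proof -
  have "row_map p d W (weyl_u p \<zeta>) = mat_sum d (\<lambda>a. u * (W a * mat_adjoint (W a))) p"
    unfolding weyl_u_def row_map_mat_diag[OF W_carrier]
    using u_carrier
    by (intro mat_sum_cong) (simp add: u_W mult_smult_assoc_mat[of _ d d _ d]
        flip: assoc_mult_mat[of _ d d _ d _ d])
  also have "\<dots> = u"
    using u_carrier by (simp add: sum_W_adjoint WW_carrier flip: mult_mat_sum)
  finally show ?thesis .
qed

text \<open>The cyclic shift of the index is a left factor \<open>v\<close> by \<open>v_W\<close>,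
  which again factors out.\<close>

lemma row_map_v: "row_map p d W (weyl_v p) = v"
proof -
  have "row_map p d W (weyl_v p) = mat_sum d (\<lambda>b. v * (W b * mat_adjoint (W b))) p"
    unfolding row_map_weyl_v[OF p]
    using v_carrier
    by (intro mat_sum_cong) (simp add: v_W assoc_mult_mat[of _ d d _ d _ d])
  also have "\<dots> = v"
    using v_carrier by (simp add: sum_W_adjoint WW_carrier flip: mult_mat_sum)
  finally show ?thesis .
qed

lemma row_map_one: "row_map p d W (1\<^sub>m p) = 1\<^sub>m d"
proof -
  have "1\<^sub>m p = mat_diag p (\<lambda>_. 1 :: complex)"
    by (auto simp: mat_diag_def intro!: eq_matI)
  moreover have "mat_sum d (\<lambda>a. 1 \<cdot>\<^sub>m (W a * mat_adjoint (W a))) p = 1\<^sub>m d"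
    by (subst sum_W_adjoint[symmetric], intro mat_sum_cong) (auto intro!: eq_matI)
  ultimately show ?thesis
    using row_map_mat_diag[where W = W and d = d and p = p and f = "\<lambda>_. 1"] by simp
qed

lemma ucp_row_map: "ucp_map p d (row_map p d W)"
  by (simp add: ucp_map_def linear_row_map row_map_one completely_positive_row_map)

end

theorem corollary2p8:
  fixes p :: nat and \<zeta> :: complex
  assumes "p \<ge> 2"
    and "primitive_root_of_unity p \<zeta>"
  shows "universal_for_commutation p \<zeta> (weyl_u p \<zeta>) (weyl_v p)"
  unfolding universal_for_commutation_def
proof (intro allI impI, elim conjE)
  fix d u v
  assume "unitary_mat d u" "unitary_mat d v" "u ^\<^sub>m p = 1\<^sub>m d" "v ^\<^sub>m p = 1\<^sub>m d"
    "u * v = \<zeta> \<cdot>\<^sub>m (v * u)"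
  with assms interpret weyl_pair p d \<zeta> u v
    by unfold_locales
  show "\<exists>\<Phi>. ucp_map p d \<Phi> \<and> \<Phi> (weyl_u p \<zeta>) = u \<and> \<Phi> (weyl_v p) = v"
    using ucp_row_map row_map_u row_map_v by blast
qed

end
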